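(* For each fixed $c>0$ and $0<a<\frac{3\sqrt{3}\,c^2}{16}$ there exists a unique smooth solitary wave solution $u(x,t)=\phi(x-ct)$ of the Novikov equation $$u_t-u_{xxt}=u^2u_{xxx}-4u^2u_x+3uu_xu_{xx}$$ whose profile $\phi$ satisfies the profile equation $\phi-\phi''=\dfrac{a}{(c-\phi^2)^{3/2}}$ on $\mathbb{R}$, the conditions $$\phi(x)^2<c\quad\text{and}\quad \phi(x)-\phi''(x)>0\quad\text{for all }x\in\mathbb{R},$$ and $\phi'(0)=0$. Further, $\phi$ is even and monotonically decreasing on $(0,\infty)$.
   Context: A smooth solitary wave with speed $c$ is a solution of the form $u(x,t)=\phi(x-ct)$ with $\phi\in C^\infty(\mathbb{R})$ nonconstant and such that $\phi(x)$ converges to one and the same finite constant as $x\to+\infty$ and as $x\to-\infty$ (i.e. $(\phi,\phi')$ is a homoclinic orbit of the second-order profile ODE). Under the conditions $\phi^2<c$ and $\phi-\phi''>0$, the traveling wave ODE for the Novikov equation, $(\phi^2-c)(\phi-\phi'')'+3\phi\phi'(\phi-\phi'')=0$, integrates to $\phi-\phi''=a(c-\phi^2)^{-3/2}$, where $a>0$ is a constant of integration. *)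

theory Defs
  imports "HOL-Analysis.Analysis"
begin

definition smooth :: "(real \<Rightarrow> real) \<Rightarrow> bool" where
  "smooth f \<longleftrightarrow> (\<forall>n. (deriv ^^ n) f differentiable_on UNIV)"

text \<open>Functions of \<open>(x, t)\<close> are curried, with the space variable first.\<close>

definition Dx :: "(real \<Rightarrow> real \<Rightarrow> real) \<Rightarrow> real \<Rightarrow> real \<Rightarrow> real" where
  "Dx u x t = deriv (\<lambda>y. u y t) x"

definition Dt :: "(real \<Rightarrow> real \<Rightarrow> real) \<Rightarrow> real \<Rightarrow> real \<Rightarrow> real" where
  "Dt u x t = deriv (\<lambda>s. u x s) t"

definition x_differentiable :: "(real \<Rightarrow> real \<Rightarrow> real) \<Rightarrow> bool" where
  "x_differentiable u \<longleftrightarrow> (\<forall>t. (\<lambda>x. u x t) differentiable_on UNIV)"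

definition t_differentiable :: "(real \<Rightarrow> real \<Rightarrow> real) \<Rightarrow> bool" where
  "t_differentiable u \<longleftrightarrow> (\<forall>x. (\<lambda>t. u x t) differentiable_on UNIV)"

text \<open>Since \<open>deriv\<close> is total, existence of every partial derivative that occurs in the
  equation is required explicitly.\<close>

definition novikov_solution :: "(real \<Rightarrow> real \<Rightarrow> real) \<Rightarrow> bool" where
  "novikov_solution u \<longleftrightarrow>
     t_differentiable u \<and> x_differentiable u \<and> x_differentiable (Dx u) \<and>
     x_differentiable (Dx (Dx u)) \<and> t_differentiable (Dx (Dx u)) \<and>
     (\<forall>x t. Dt u x t - Dt (Dx (Dx u)) x t =
        (u x t)\<^sup>2 * Dx (Dx (Dx u)) x t - 4 * (u x t)\<^sup>2 * Dx u x t
          + 3 * u x t * Dx u x t * Dx (Dx u) x t)"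

definition smooth_solitary_wave :: "real \<Rightarrow> (real \<Rightarrow> real) \<Rightarrow> bool" where
  "smooth_solitary_wave c \<phi> \<longleftrightarrow>
     smooth \<phi> \<and> \<not> \<phi> constant_on UNIV \<and>
     (\<exists>k. (\<phi> \<longlongrightarrow> k) at_top \<and> (\<phi> \<longlongrightarrow> k) at_bot) \<and>
     novikov_solution (\<lambda>x t. \<phi> (x - c * t))"

definition novikov_wave_profile :: "real \<Rightarrow> real \<Rightarrow> (real \<Rightarrow> real) \<Rightarrow> bool" where
  "novikov_wave_profile c a \<phi> \<longleftrightarrow>
     smooth_solitary_wave c \<phi> \<and>
     (\<forall>x. \<phi> x - deriv (deriv \<phi>) x = a / (c - (\<phi> x)\<^sup>2) powr (3/2)) \<and>
     (\<forall>x. (\<phi> x)\<^sup>2 < c \<and> \<phi> x - deriv (deriv \<phi>) x > 0) \<and>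
     deriv \<phi> 0 = 0"

end

theory Submission imports Defs begin

text \<open>Write \<open>a = c\<^sup>2 p / (1 + p\<^sup>2)\<^sup>2\<close> with \<open>0 < p < 1/\<surd>3\<close>, and \<open>t = \<phi> / \<surd>(c - \<phi>\<^sup>2)\<close>. For a solution with
  limit \<open>t = q\<close> at infinity the conserved energy factors as
  \<open>(1 + q\<^sup>2)\<^sup>2 (1 + t\<^sup>2) \<phi>'\<^sup>2 = c (t - q)\<^sup>2 (1 - q\<^sup>2 - 2 q t)\<close>. If \<open>q > 1/\<surd>3\<close>, the right-hand side is
  negative for \<open>t\<close> near \<open>q\<close>, \<open>t \<noteq> q\<close>, so the solution is constant; hence \<open>q = p\<close>, and \<open>\<phi>'(0) = 0\<close> forces
  \<open>t(0) = (1 - p\<^sup>2) / (2 p)\<close>. Uniqueness and evenness follow from uniqueness for the initial value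
  problem.

  For existence, \<open>w\<^sup>2 = 1 - p\<^sup>2 - 2 p t\<close> turns the energy identity into the first-order equation
  \<open>w' = p (1 + t\<^sup>2) (t - p) / (1 + p\<^sup>2)\<close>, which is solved by quadrature. Smoothness holds because the
  algebra generated by \<open>\<phi>\<close>, \<open>\<phi>'\<close> and \<open>(c - \<phi>\<^sup>2)\<^bsup>-1/2\<^esup>\<close> is closed under differentiation.\<close>

text \<open>The derivative is carried as a second function, so that a solution is an orbit of a
  planar system, and the power \<open>3/2\<close> is written as a cube of a square root, so that
  later identities are polynomial in that root or its reciprocal.\<close>

definition profile_solution :: "real \<Rightarrow> real \<Rightarrow> (real \<Rightarrow> real) \<Rightarrow> (real \<Rightarrow> real) \<Rightarrow> bool" where
  "profile_solution c a \<phi> \<psi> \<longleftrightarrow>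
     (\<forall>x. (\<phi> x)\<^sup>2 < c \<and> (\<phi> has_real_derivative \<psi> x) (at x) \<and>
        (\<psi> has_real_derivative \<phi> x - a / sqrt (c - (\<phi> x)\<^sup>2) ^ 3) (at x))"

lemma profile_solutionD:
  assumes "profile_solution c a \<phi> \<psi>"
  shows "(\<phi> x)\<^sup>2 < c" "(\<phi> has_real_derivative \<psi> x) (at x)"
    "(\<psi> has_real_derivative \<phi> x - a / sqrt (c - (\<phi> x)\<^sup>2) ^ 3) (at x)"
  using assms by (auto simp: profile_solution_def)

lemma powr_three_halves: "x powr (3/2) = sqrt x ^ 3" if "x \<ge> 0" for x :: real
proof -
  have "x powr (3/2) = (x powr (1/2)) powr 3"
    by (simp add: powr_powr)
  also have "\<dots> = sqrt x ^ 3"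
    using that by (simp add: powr_half_sqrt powr_numeral)
  finally show ?thesis .
qed

subsection \<open>Smoothness\<close>

text \<open>Induction on the order keeps every iterated derivative inside \<open>A\<close>, so no
  formula for higher derivatives is needed.\<close>

lemma smoothI_closed_family:
  assumes "f \<in> A" and "\<And>g. g \<in> A \<Longrightarrow> \<exists>g'\<in>A. \<forall>x. (g has_real_derivative g' x) (at x)"
  shows "smooth f"
proof -
  have deriv_closed: "g differentiable_on UNIV \<and> deriv g \<in> A" if g: "g \<in> A" for g
  proof -
    obtain g' where g': "g' \<in> A" "\<And>x. (g has_real_derivative g' x) (at x)"
      using assms(2)[OF g] by auto
    then have "deriv g = g'"
      by (intro ext DERIV_imp_deriv)
    with g' show ?thesis
      by (auto simp: differentiable_on_def real_differentiable_def)
  qed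
  have "(deriv ^^ n) f \<in> A" for n
    by (induction n) (use assms(1) deriv_closed in auto)
  then show ?thesis
    by (simp add: smooth_def deriv_closed)
qed

inductive_set generated_algebra :: "(real \<Rightarrow> real) set \<Rightarrow> (real \<Rightarrow> real) set" for B where
  gen: "f \<in> B \<Longrightarrow> f \<in> generated_algebra B"
| const: "(\<lambda>x. k) \<in> generated_algebra B"
| add: "f \<in> generated_algebra B \<Longrightarrow> g \<in> generated_algebra B \<Longrightarrow> (\<lambda>x. f x + g x) \<in> generated_algebra B"
| mult: "f \<in> generated_algebra B \<Longrightarrow> g \<in> generated_algebra B \<Longrightarrow> (\<lambda>x. f x * g x) \<in> generated_algebra B"

text \<open>The sum and product rules reduce closure under differentiation to a check on the
  generators.\<close>

lemma generated_algebra_derivative_closed: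
  assumes "\<And>f. f \<in> B \<Longrightarrow> \<exists>f'\<in>generated_algebra B. \<forall>x. (f has_real_derivative f' x) (at x)"
    and "f \<in> generated_algebra B"
  shows "\<exists>f'\<in>generated_algebra B. \<forall>x. (f has_real_derivative f' x) (at x)"
  using assms(2)
proof induction
  case (gen f)
  then show ?case using assms(1) by blast
next
  case (const k)
  show ?case by (rule bexI[OF _ generated_algebra.const[of 0]]) auto
next
  case (add f g)
  then obtain f' g' where "f' \<in> generated_algebra B" "g' \<in> generated_algebra B"
    "\<And>x. (f has_real_derivative f' x) (at x)" "\<And>x. (g has_real_derivative g' x) (at x)"
    by blast
  then show ?case
    by (intro bexI[of _ "\<lambda>x. f' x + g' x"]) (auto intro!: generated_algebra.add derivative_eq_intros)
next
  case (mult f g)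
  then obtain f' g' where *: "f' \<in> generated_algebra B" "g' \<in> generated_algebra B"
    "\<And>x. (f has_real_derivative f' x) (at x)" "\<And>x. (g has_real_derivative g' x) (at x)"
    by blast
  have "(\<lambda>x. f' x * g x + f x * g' x) \<in> generated_algebra B"
    by (intro generated_algebra.add generated_algebra.mult * mult)
  moreover have "((\<lambda>x. f x * g x) has_real_derivative f' x * g x + f x * g' x) (at x)" for x
    by (auto intro!: derivative_eq_intros *)
  ultimately show ?case
    by (intro bexI[of _ "\<lambda>x. f' x * g x + f x * g' x"]) auto
qed

lemma generated_algebra_power:
  "f \<in> generated_algebra B \<Longrightarrow> (\<lambda>x. f x ^ n) \<in> generated_algebra B"
  by (induction n) (auto intro: generated_algebra.intros)

lemma profile_inverse_sqrt_derivative: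
  assumes "profile_solution c a \<phi> \<psi>"
  shows "((\<lambda>x. 1 / sqrt (c - (\<phi> x)\<^sup>2)) has_real_derivative
           \<phi> x * \<psi> x * (1 / sqrt (c - (\<phi> x)\<^sup>2)) ^ 3) (at x)"
proof -
  have "c - (\<phi> x)\<^sup>2 > 0" using profile_solutionD(1)[OF assms, of x] by simp
  then show ?thesis
    by (auto intro!: derivative_eq_intros profile_solutionD(2)[OF assms]
        simp: field_simps power3_eq_cube power2_eq_square)
qed

lemma profile_solution_smooth:
  assumes "profile_solution c a \<phi> \<psi>"
  shows "smooth \<phi>"
proof -
  \<comment> \<open>Adjoining the reciprocal root as a third generator removes all division: the
    derivatives of \<phi>, \<psi> and \<open>R\<close> are polynomials in these three
    functions.\<close>
  define R where "R = (\<lambda>x. 1 / sqrt (c - (\<phi> x)\<^sup>2))"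
  let ?A = "generated_algebra {\<phi>, \<psi>, R}"
  have gens: "\<phi> \<in> ?A" "\<psi> \<in> ?A" "R \<in> ?A"
    by (auto intro: generated_algebra.gen)
  have "(\<lambda>x. \<phi> x + (- a) * R x ^ 3) \<in> ?A"
    by (intro generated_algebra.add generated_algebra.mult generated_algebra.const generated_algebra_power gens)
  moreover have "\<forall>x. (\<psi> has_real_derivative \<phi> x + (- a) * R x ^ 3) (at x)"
    using profile_solutionD(3)[OF assms] by (simp add: R_def power_divide)
  ultimately have \<psi>: "\<exists>f'\<in>?A. \<forall>x. (\<psi> has_real_derivative f' x) (at x)"
    by (intro bexI[of _ "\<lambda>x. \<phi> x + (- a) * R x ^ 3"])
  have "(\<lambda>x. (\<phi> x * \<psi> x) * R x ^ 3) \<in> ?A"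
    by (intro generated_algebra.mult generated_algebra_power gens)
  moreover have "\<forall>x. (R has_real_derivative (\<phi> x * \<psi> x) * R x ^ 3) (at x)"
    using profile_inverse_sqrt_derivative[OF assms] by (simp add: R_def power_divide)
  ultimately have R: "\<exists>f'\<in>?A. \<forall>x. (R has_real_derivative f' x) (at x)"
    by (intro bexI[of _ "\<lambda>x. (\<phi> x * \<psi> x) * R x ^ 3"])
  have \<phi>: "\<exists>f'\<in>?A. \<forall>x. (\<phi> has_real_derivative f' x) (at x)"
    using gens(2) profile_solutionD(2)[OF assms] by (intro bexI[of _ \<psi>]) auto
  have "\<exists>f'\<in>?A. \<forall>x. (f has_real_derivative f' x) (at x)" if "f \<in> {\<phi>, \<psi>, R}" for f
    using that \<phi> \<psi> R by auto
  from smoothI_closed_family[OF gens(1) generated_algebra_derivative_closed[OF this]]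
  show ?thesis
    by simp
qed

subsection \<open>From the profile equation to the Novikov equation\<close>

lemma has_real_derivative_travelling_wave:
  assumes "\<And>x. (f has_real_derivative f' x) (at x)"
  shows "((\<lambda>x. f (x - c * t)) has_real_derivative f' (x - c * t)) (at x)"
    and "((\<lambda>t. f (x - c * t)) has_real_derivative - c * f' (x - c * t)) (at t)"
  by (auto intro!: derivative_eq_intros DERIV_chain2[OF assms, THEN DERIV_cong])

text \<open>Both partial derivatives are again travelling waves up to a factor, so the lemma can be
  applied repeatedly to reach all derivatives in the Novikov equation.\<close>

lemma travelling_wave_derivatives:
  assumes "\<And>x. (f has_real_derivative f' x) (at x)"
  shows "Dx (\<lambda>x t. f (x - c * t)) = (\<lambda>x t. f' (x - c * t))"
    and "Dt (\<lambda>x t. f (x - c * t)) = (\<lambda>x t. - c * f' (x - c * t))"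
    and "x_differentiable (\<lambda>x t. f (x - c * t))"
    and "t_differentiable (\<lambda>x t. f (x - c * t))"
  using has_real_derivative_travelling_wave[OF assms]
  by (auto simp: Dx_def Dt_def x_differentiable_def t_differentiable_def differentiable_on_def
      fun_eq_iff real_differentiable_def intro!: DERIV_imp_deriv exI)

lemma profile_solution_imp_novikov_solution:
  assumes "profile_solution c a \<phi> \<psi>"
  shows "novikov_solution (\<lambda>x t. \<phi> (x - c * t))"
proof -
  define R where "R = (\<lambda>x. 1 / sqrt (c - (\<phi> x)\<^sup>2))"
  define \<eta> where "\<eta> = (\<lambda>x. \<phi> x - a * R x ^ 3)"
  define \<omega> where "\<omega> = (\<lambda>x. \<psi> x - 3 * a * \<phi> x * \<psi> x * R x ^ 5)"
  note \<phi> = profile_solutionD(2)[OF assms]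
  have \<psi>: "(\<psi> has_real_derivative \<eta> x) (at x)" for x
    using profile_solutionD(3)[OF assms, of x] by (simp add: \<eta>_def R_def power_divide)
  have R: "(R has_real_derivative \<phi> x * \<psi> x * R x ^ 3) (at x)" for x
    using profile_inverse_sqrt_derivative[OF assms] by (simp add: R_def)
  have \<eta>: "(\<eta> has_real_derivative \<omega> x) (at x)" for x
    unfolding \<eta>_def \<omega>_def
    by (auto intro!: derivative_eq_intros \<phi> R simp: power_numeral_reduce)
  have equation: "- c * \<psi> x - (- c * \<omega> x) =
      (\<phi> x)\<^sup>2 * \<omega> x - 4 * (\<phi> x)\<^sup>2 * \<psi> x + 3 * \<phi> x * \<psi> x * \<eta> x" for x
  proof -
    \<comment> \<open>With \<eta> and \<omega> as second and third derivative of \<phi>, the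
      travelling wave equation is a polynomial identity modulo this one relation.\<close>
    have "(c - (\<phi> x)\<^sup>2) * (R x)\<^sup>2 = 1"
      using profile_solutionD(1)[OF assms, of x] by (simp add: R_def power_divide)
    then show ?thesis
      unfolding \<eta>_def \<omega>_def by algebra
  qed
  show ?thesis
    unfolding novikov_solution_def
    by (simp add: travelling_wave_derivatives[OF \<phi>] travelling_wave_derivatives[OF \<psi>]
        travelling_wave_derivatives[OF \<eta>] equation[simplified])
qed

text \<open>Positivity of \<phi> - \<phi>'' follows from the profile equation and
  \<open>a > 0\<close>.\<close>

lemma novikov_wave_profileI:
  assumes sol: "profile_solution c a \<phi> \<psi>" and "a > 0" and "\<psi> 0 = 0"
    and "\<not> \<phi> constant_on UNIV" "(\<phi> \<longlongrightarrow> k) at_top" "(\<phi> \<longlongrightarrow> k) at_bot"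
  shows "novikov_wave_profile c a \<phi>"
proof -
  have 1: "deriv \<phi> = \<psi>"
    by (intro ext DERIV_imp_deriv profile_solutionD(2)[OF sol])
  have 2: "deriv \<psi> x = \<phi> x - a / sqrt (c - (\<phi> x)\<^sup>2) ^ 3" for x
    by (intro DERIV_imp_deriv profile_solutionD(3)[OF sol])
  have "(\<phi> x)\<^sup>2 < c" for x
    using profile_solutionD(1)[OF sol] .
  then show ?thesis
    using assms profile_solution_smooth[OF sol] profile_solution_imp_novikov_solution[OF sol]
    by (auto simp: novikov_wave_profile_def smooth_solitary_wave_def 1 2 powr_three_halves less_imp_le)
qed

lemma novikov_wave_profileD:
  assumes "novikov_wave_profile c a \<phi>"
  shows "profile_solution c a \<phi> (deriv \<phi>)" "deriv \<phi> 0 = 0" "\<not> \<phi> constant_on UNIV"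
    "\<exists>k. (\<phi> \<longlongrightarrow> k) at_top"
proof -
  have bound: "(\<phi> x)\<^sup>2 < c" for x
    using assms by (auto simp: novikov_wave_profile_def)
  have eq: "deriv (deriv \<phi>) x = \<phi> x - a / sqrt (c - (\<phi> x)\<^sup>2) ^ 3" for x
  proof -
    have "\<phi> x - deriv (deriv \<phi>) x = a / (c - (\<phi> x)\<^sup>2) powr (3/2)"
      using assms by (auto simp: novikov_wave_profile_def)
    then show ?thesis
      using bound[of x] by (simp add: powr_three_halves)
  qed
  have smooth: "(deriv ^^ n) \<phi> differentiable_on UNIV" for n
    using assms by (auto simp: novikov_wave_profile_def smooth_solitary_wave_def smooth_def)
  have deriv: "(f has_real_derivative deriv f x) (at x)" if "f differentiable_on UNIV" for f and x :: real
    using that by (simp add: differentiable_on_def DERIV_deriv_iff_real_differentiable)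
  show "profile_solution c a \<phi> (deriv \<phi>)"
    using bound deriv[of \<phi>] deriv[of "deriv \<phi>"] smooth[of 0] smooth[of 1]
    by (simp add: profile_solution_def flip: eq)
qed (use assms in \<open>auto simp: novikov_wave_profile_def smooth_solitary_wave_def\<close>)

subsection \<open>Uniqueness for the initial value problem\<close>

text \<open>Gronwall argument: an exponentially weighted squared distance between the two phase
  points is nonincreasing and starts at zero.\<close>

lemma second_order_ode_unique_forward:
  fixes u v u' v' f f' :: "real \<Rightarrow> real"
  assumes u: "\<And>x. (u has_real_derivative u' x) (at x)"
      "\<And>x. (u' has_real_derivative f (u x)) (at x)" "\<And>x. u x \<in> {l<..<r}"
    and v: "\<And>x. (v has_real_derivative v' x) (at x)"
      "\<And>x. (v' has_real_derivative f (v x)) (at x)" "\<And>x. v x \<in> {l<..<r}"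
    and f: "\<And>s. s \<in> {l<..<r} \<Longrightarrow> (f has_real_derivative f' s) (at s)"
      "continuous_on {l<..<r} f'"
    and init: "u x0 = v x0" "u' x0 = v' x0" and "x0 \<le> x"
  shows "u x = v x"
proof -
  have cont: "continuous_on {x0..x} u" "continuous_on {x0..x} v"
    using u(1) v(1) by (auto intro!: DERIV_atLeastAtMost_imp_continuous_on)
  \<comment> \<open>Over a compact time interval both trajectories lie in one compact
    \<open>{m..M}\<close> inside the open domain, where \<open>f'\<close> is bounded and
    \<open>f\<close> is therefore Lipschitz.\<close>
  have "compact (u ` {x0..x} \<union> v ` {x0..x})" (is "compact ?C")
    using cont by (intro compact_Un compact_continuous_image compact_Icc)
  moreover have "?C \<noteq> {}" using \<open>x0 \<le> x\<close> by auto
  ultimately obtain m M where mM: "m \<in> ?C" "M \<in> ?C" "\<And>s. s \<in> ?C \<Longrightarrow> m \<le> s \<and> s \<le> M"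
    using compact_attains_inf[of ?C] compact_attains_sup[of ?C] by metis
  have "m \<in> {l<..<r}" "M \<in> {l<..<r}"
    using mM(1,2) u(3) v(3) by blast+
  then have sub: "{m..M} \<subseteq> {l<..<r}"
    by auto
  have "compact (f' ` {m..M})"
    using continuous_on_subset[OF f(2) sub] by (intro compact_continuous_image compact_Icc)
  from compact_imp_bounded[OF this]
  obtain L where L: "\<And>s. s \<in> {m..M} \<Longrightarrow> \<bar>f' s\<bar> \<le> L"
    by (force simp: bounded_iff)
  have lip: "\<bar>f s - f t\<bar> \<le> L * \<bar>s - t\<bar>" if "s \<in> {m..M}" "t \<in> {m..M}" for s t
  proof -
    have "(f has_field_derivative f' z) (at z within {m..M})" if "z \<in> {m..M}" for z
      using f(1) sub that by (blast intro: has_field_derivative_at_within)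
    then show ?thesis
      using field_differentiable_bound[of "{m..M}" f f' L s t] that L by auto
  qed
  define E where "E = (\<lambda>y. exp (- (1 + L) * y) * ((u y - v y)\<^sup>2 + (u' y - v' y)\<^sup>2))"
  have E': "\<exists>d. (E has_real_derivative d) (at y) \<and> d \<le> 0" if "x0 \<le> y" "y \<le> x" for y
  proof -
    define p q g where "p = u y - v y" and "q = u' y - v' y" and "g = f (u y) - f (v y)"
    have "(E has_real_derivative exp (- (1 + L) * y) * (2 * p * q + 2 * q * g - (1 + L) * (p\<^sup>2 + q\<^sup>2))) (at y)"
      unfolding E_def p_def q_def g_def
      by (auto intro!: derivative_eq_intros u(1,2) v(1,2) simp: algebra_simps)
    \<comment> \<open>This explains the rate \<open>1 + L\<close>: relative to
      \<open>p\<^sup>2 + q\<^sup>2\<close>, the term \<open>2 * p * q\<close> costs at most 1 and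
      \<open>2 * q * g\<close> at most \<open>L\<close>.\<close>
    moreover have "2 * p * q + 2 * q * g \<le> (1 + L) * (p\<^sup>2 + q\<^sup>2)"
    proof -
      have g: "\<bar>g\<bar> \<le> L * \<bar>p\<bar>"
        unfolding g_def p_def using that by (intro lip) (use mM(3) in auto)
      have "L \<ge> 0" using L[of m] mM(1,3) by fastforce
      have "q * g \<le> \<bar>q\<bar> * \<bar>g\<bar>" by (metis abs_ge_self abs_mult)
      also have "\<dots> \<le> \<bar>q\<bar> * (L * \<bar>p\<bar>)" by (intro mult_left_mono g) auto
      finally have "2 * (q * g) \<le> L * (2 * \<bar>p\<bar> * \<bar>q\<bar>)" by (simp add: algebra_simps)
      also have "\<dots> \<le> L * (p\<^sup>2 + q\<^sup>2)"
        using \<open>L \<ge> 0\<close> sum_squares_bound[of "\<bar>p\<bar>" "\<bar>q\<bar>"] by (intro mult_left_mono) auto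
      finally show ?thesis
        using sum_squares_bound[of p q] by (simp add: algebra_simps)
    qed
    ultimately show ?thesis
      by (intro exI conjI) (auto simp: mult_le_0_iff)
  qed
  have "E x \<le> E x0"
    by (rule DERIV_nonpos_imp_nonincreasing[OF \<open>x0 \<le> x\<close>]) (use E' in auto)
  then have "(u x - v x)\<^sup>2 + (u' x - v' x)\<^sup>2 \<le> 0"
    using init by (simp add: E_def mult_le_0_iff)
  then show ?thesis
    by (smt (verit) zero_le_power2 zero_eq_power2)
qed

lemma has_real_derivative_reflect:
  fixes g g' :: "real \<Rightarrow> real"
  assumes "\<And>x. (g has_real_derivative g' x) (at x)"
  shows "((\<lambda>x. g (- x)) has_real_derivative - g' (- x)) (at x)"
  using DERIV_chain2[OF assms DERIV_minus[OF DERIV_ident]] by simp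

lemma second_order_ode_unique:
  fixes u v u' v' f f' :: "real \<Rightarrow> real"
  assumes u: "\<And>x. (u has_real_derivative u' x) (at x)"
      "\<And>x. (u' has_real_derivative f (u x)) (at x)" "\<And>x. u x \<in> {l<..<r}"
    and v: "\<And>x. (v has_real_derivative v' x) (at x)"
      "\<And>x. (v' has_real_derivative f (v x)) (at x)" "\<And>x. v x \<in> {l<..<r}"
    and f: "\<And>s. s \<in> {l<..<r} \<Longrightarrow> (f has_real_derivative f' s) (at s)"
      "continuous_on {l<..<r} f'"
    and init: "u x0 = v x0" "u' x0 = v' x0"
  shows "u x = v x"
proof (cases "x0 \<le> x")
  case True
  show ?thesis by (rule second_order_ode_unique_forward[OF assms True])
next
  case False
  \<comment> \<open>Without a first-derivative term the equation is invariant under reflection, so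
    the backward case is the forward case of the reflected solutions.\<close>
  have "(\<lambda>x. u (- x)) (- x) = (\<lambda>x. v (- x)) (- x)"
  proof (rule second_order_ode_unique_forward[where u = "\<lambda>x. u (- x)" and u' = "\<lambda>x. - u' (- x)"
        and v = "\<lambda>x. v (- x)" and v' = "\<lambda>x. - v' (- x)" and ?x0.0 = "- x0" and f = f and f' = f'
        and l = l and r = r])
    show "((\<lambda>x. - u' (- x)) has_real_derivative f (u (- x))) (at x)" for x
      using DERIV_minus[OF has_real_derivative_reflect[OF u(2)]] by simp
    show "((\<lambda>x. - v' (- x)) has_real_derivative f (v (- x))) (at x)" for x
      using DERIV_minus[OF has_real_derivative_reflect[OF v(2)]] by simp
  qed (use has_real_derivative_reflect[OF u(1)] has_real_derivative_reflect[OF v(1)] u(3) v(3) f init False in auto)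
  then show ?thesis by simp
qed

text \<open>The force is continuously differentiable on the open interval between the two square
  roots of \<open>c\<close>, and both profiles take their values there.\<close>

lemma profile_solution_unique:
  assumes u: "profile_solution c a u u'" and v: "profile_solution c a v v'"
    and "u x0 = v x0" "u' x0 = v' x0"
  shows "u = v"
proof
  fix x
  have in_iff: "s \<in> {- sqrt c<..<sqrt c} \<longleftrightarrow> s\<^sup>2 < c" for s
    by (metis abs_less_iff greaterThanLessThan_iff minus_less_iff real_sqrt_abs real_sqrt_less_iff)
  let ?f' = "\<lambda>s. 1 - a * (3 * s / sqrt (c - s\<^sup>2) ^ 5)"
  show "u x = v x"
  proof (rule second_order_ode_unique[where f = "\<lambda>s. s - a / sqrt (c - s\<^sup>2) ^ 3" and f' = ?f'
        and l = "- sqrt c" and r = "sqrt c"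
        and u = u and u' = u' and v = v and v' = v' and ?x0.0 = x0])
    fix s assume "s \<in> {- sqrt c<..<sqrt c}"
    then have "c - s\<^sup>2 > 0" using in_iff by simp
    then have sqrt: "((\<lambda>s. sqrt (c - s\<^sup>2)) has_real_derivative - s / sqrt (c - s\<^sup>2)) (at s)"
        and pos: "sqrt (c - s\<^sup>2) > 0"
      by (auto intro!: derivative_eq_intros simp: field_simps)
    have "((\<lambda>s. s - a / sqrt (c - s\<^sup>2) ^ 3) has_real_derivative
        1 - (0 * sqrt (c - s\<^sup>2) ^ 3 - a * (3 * (- s / sqrt (c - s\<^sup>2) * sqrt (c - s\<^sup>2) ^ 2)))
          / (sqrt (c - s\<^sup>2) ^ 3 * sqrt (c - s\<^sup>2) ^ 3)) (at s)"
      using pos by (intro derivative_intros sqrt DERIV_power[OF sqrt, THEN DERIV_cong]) auto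
    then show "((\<lambda>s. s - a / sqrt (c - s\<^sup>2) ^ 3) has_real_derivative ?f' s) (at s)"
    proof (rule DERIV_cong)
      \<comment> \<open>The quotient-rule expression is simplified for an abstract positive
        \<open>g\<close>, so that the root stays an atom.\<close>
      have "1 - (0 * g ^ 3 - a * (3 * (- s / g * g ^ 2))) / (g ^ 3 * g ^ 3) = 1 - a * (3 * s / g ^ 5)"
        if "g > 0" for g
        using that by (simp add: field_simps power_numeral_reduce)
      from this[OF pos] show "1 - (0 * sqrt (c - s\<^sup>2) ^ 3 - a * (3 * (- s / sqrt (c - s\<^sup>2) * sqrt (c - s\<^sup>2) ^ 2)))
          / (sqrt (c - s\<^sup>2) ^ 3 * sqrt (c - s\<^sup>2) ^ 3) = ?f' s" .
    qed
  next
    have "c - s\<^sup>2 \<noteq> 0" if "s \<in> {- sqrt c<..<sqrt c}" for s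
      using that in_iff by force
    then show "continuous_on {- sqrt c<..<sqrt c} ?f'"
      by (intro continuous_intros) auto
  qed (use assms in_iff profile_solutionD[OF u] profile_solutionD[OF v] in auto)
qed

subsection \<open>The limit at infinity\<close>

text \<open>The mean value theorem is applied twice, first to the forward difference of
  \<open>f\<close> and then to \<open>f'\<close>.\<close>

lemma second_difference_mvt:
  fixes f f' f'' :: "real \<Rightarrow> real"
  assumes "\<And>x. (f has_real_derivative f' x) (at x)" "\<And>x. (f' has_real_derivative f'' x) (at x)"
  shows "\<exists>\<xi>\<ge>x. f (x + 2) - 2 * f (x + 1) + f x = f'' \<xi>"
proof -
  have "((\<lambda>y. f (y + 1) - f y) has_real_derivative f' (y + 1) - f' y) (at y)" for y
    by (auto intro!: derivative_eq_intros DERIV_chain2[OF assms(1)] assms(1))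
  then obtain \<eta> where \<eta>: "x < \<eta>"
    "(f (x + 1 + 1) - f (x + 1)) - (f (x + 1) - f x) = (x + 1 - x) * (f' (\<eta> + 1) - f' \<eta>)"
    using MVT2[of x "x + 1" "\<lambda>y. f (y + 1) - f y" "\<lambda>y. f' (y + 1) - f' y"] by auto
  obtain \<xi> where "\<eta> < \<xi>" "f' (\<eta> + 1) - f' \<eta> = (\<eta> + 1 - \<eta>) * f'' \<xi>"
    using MVT2[of \<eta> "\<eta> + 1" f' f''] assms(2) by auto
  with \<eta> show ?thesis
    by (intro exI[of _ \<xi>]) (auto simp: add.assoc)
qed

lemma filterlim_at_top_of_nat_le:
  assumes "\<And>n. real n \<le> \<xi> n"
  shows "filterlim \<xi> at_top sequentially"
  using assms by (intro filterlim_at_top_mono[OF filterlim_real_sequentially]) auto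

lemma tendsto_at_top_shift:
  fixes f :: "real \<Rightarrow> real"
  assumes "(f \<longlongrightarrow> k) at_top"
  shows "(\<lambda>n. f (real n + d)) \<longlonglongrightarrow> k"
  by (rule filterlim_compose[OF assms])
    (use filterlim_tendsto_add_at_top[OF tendsto_const filterlim_real_sequentially, of d]
      in \<open>simp add: add.commute\<close>)

text \<open>Convergence of \<open>f\<close> alone does not make \<open>f'\<close> converge, but unit
  increments of \<open>f\<close> tend to zero and each is a value of \<open>f'\<close>. A sequence
  is enough for reading off limits.\<close>

lemma limit_derivative_along_sequence:
  fixes f f' :: "real \<Rightarrow> real"
  assumes "\<And>x. (f has_real_derivative f' x) (at x)" "(f \<longlongrightarrow> k) at_top"
  obtains \<xi> :: "nat \<Rightarrow> real" where "filterlim \<xi> at_top sequentially" "(\<lambda>n. f' (\<xi> n)) \<longlonglongrightarrow> 0"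
proof -
  have "\<exists>\<xi>\<ge>real n. f (real n + 1) - f (real n) = f' \<xi>" for n
    using MVT2[of "real n" "real n + 1" f f', OF _ assms(1)] by (auto intro: less_imp_le)
  then obtain \<xi> where \<xi>: "\<And>n. real n \<le> \<xi> n" "\<And>n. f (real n + 1) - f (real n) = f' (\<xi> n)"
    by metis
  have "(\<lambda>n. f (real n + 1) - f (real n)) \<longlonglongrightarrow> k - k"
    using tendsto_at_top_shift[OF assms(2), of 0] tendsto_at_top_shift[OF assms(2), of 1]
    by (intro tendsto_diff) auto
  then show ?thesis
    using that[OF filterlim_at_top_of_nat_le[OF \<xi>(1)]] \<xi>(2) by simp
qed

lemma limit_second_derivative_along_sequence:
  fixes f f' f'' :: "real \<Rightarrow> real"
  assumes "\<And>x. (f has_real_derivative f' x) (at x)" "\<And>x. (f' has_real_derivative f'' x) (at x)"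
    and lim: "(f \<longlongrightarrow> k) at_top"
  obtains \<xi> :: "nat \<Rightarrow> real" where "filterlim \<xi> at_top sequentially" "(\<lambda>n. f'' (\<xi> n)) \<longlonglongrightarrow> 0"
proof -
  have "\<exists>\<xi>\<ge>real n. f (real n + 2) - 2 * f (real n + 1) + f (real n) = f'' \<xi>" for n
    by (rule second_difference_mvt[OF assms(1,2)])
  then obtain \<xi> where \<xi>: "\<And>n. real n \<le> \<xi> n"
    "\<And>n. f (real n + 2) - 2 * f (real n + 1) + f (real n) = f'' (\<xi> n)"
    by metis
  have "(\<lambda>n. f (real n + 2) - 2 * f (real n + 1) + f (real n)) \<longlonglongrightarrow> k - 2 * k + k"
    using tendsto_at_top_shift[OF lim, of 0]
    by (intro tendsto_intros tendsto_at_top_shift[OF lim]) auto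
  then show ?thesis
    using that[OF filterlim_at_top_of_nat_le[OF \<xi>(1)]] \<xi>(2) by simp
qed

text \<open>Multiplying the equation by \<open>(c - \<phi>\<^sup>2)\<^bsup>3/2\<^esup>\<close> before passing to the limit also excludes
  \<open>k\<^sup>2 = c\<close>.\<close>

lemma profile_limit_equation:
  assumes sol: "profile_solution c a \<phi> \<psi>" and lim: "(\<phi> \<longlongrightarrow> k) at_top" and "a > 0"
  shows "k * sqrt (c - k\<^sup>2) ^ 3 = a" "k > 0" "k\<^sup>2 < c"
proof -
  obtain \<xi> :: "nat \<Rightarrow> real" where \<xi>: "filterlim \<xi> at_top sequentially"
      "(\<lambda>n. \<phi> (\<xi> n) - a / sqrt (c - (\<phi> (\<xi> n))\<^sup>2) ^ 3) \<longlonglongrightarrow> 0"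
    using limit_second_derivative_along_sequence[OF profile_solutionD(2,3)[OF sol] lim] by blast
  have l: "(\<lambda>n. \<phi> (\<xi> n)) \<longlonglongrightarrow> k"
    by (rule filterlim_compose[OF lim \<xi>(1)])
  have "(\<lambda>n. (\<phi> (\<xi> n) - a / sqrt (c - (\<phi> (\<xi> n))\<^sup>2) ^ 3) * sqrt (c - (\<phi> (\<xi> n))\<^sup>2) ^ 3)
      \<longlonglongrightarrow> 0 * sqrt (c - k\<^sup>2) ^ 3"
    by (intro tendsto_intros \<xi>(2) l)
  moreover have "(s - a / sqrt (c - s\<^sup>2) ^ 3) * sqrt (c - s\<^sup>2) ^ 3 = s * sqrt (c - s\<^sup>2) ^ 3 - a"
    if "s\<^sup>2 < c" for s
    using that by (simp add: field_simps)
  ultimately have "(\<lambda>n. \<phi> (\<xi> n) * sqrt (c - (\<phi> (\<xi> n))\<^sup>2) ^ 3 - a) \<longlonglongrightarrow> 0"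
    using profile_solutionD(1)[OF sol] by simp
  moreover have "(\<lambda>n. \<phi> (\<xi> n) * sqrt (c - (\<phi> (\<xi> n))\<^sup>2) ^ 3 - a) \<longlonglongrightarrow> k * sqrt (c - k\<^sup>2) ^ 3 - a"
    by (intro tendsto_intros l)
  ultimately show eq: "k * sqrt (c - k\<^sup>2) ^ 3 = a"
    using LIMSEQ_unique by fastforce
  have "(\<lambda>n. c - (\<phi> (\<xi> n))\<^sup>2) \<longlonglongrightarrow> c - k\<^sup>2"
    by (intro tendsto_intros l)
  then have "c - k\<^sup>2 \<ge> 0"
    by (rule LIMSEQ_le_const) (use profile_solutionD(1)[OF sol] in \<open>auto simp: less_imp_le\<close>)
  moreover have "c - k\<^sup>2 \<noteq> 0" using eq \<open>a > 0\<close> by auto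
  ultimately show "k\<^sup>2 < c" by simp
  then show "k > 0"
    using eq \<open>a > 0\<close> by (simp flip: eq add: zero_less_mult_iff)
qed

subsection \<open>The energy identity\<close>

text \<open>With s = sqrt c * sin \<theta> the slope is tan \<theta>, and this is the identity for
  its secant. The slope is the variable in which the energy becomes rational.\<close>

lemma one_plus_slope_squared:
  fixes s c :: real
  assumes "s\<^sup>2 < c"
  shows "1 + (s / sqrt (c - s\<^sup>2))\<^sup>2 = c / (c - s\<^sup>2)"
  using assms by (simp add: power_divide field_simps)

lemma slope_determines_value:
  fixes s c :: real
  assumes "s\<^sup>2 < c" and "t = s / sqrt (c - s\<^sup>2)"
  shows "s = sqrt c * t / sqrt (1 + t\<^sup>2)" and "s\<^sup>2 = c * t\<^sup>2 / (1 + t\<^sup>2)"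
proof -
  have "c > 0" using assms(1) zero_le_power2[of s] by linarith
  have "sqrt (1 + t\<^sup>2) = sqrt c / sqrt (c - s\<^sup>2)"
    using one_plus_slope_squared[OF assms(1)] assms(2) by (simp add: real_sqrt_divide)
  then show s: "s = sqrt c * t / sqrt (1 + t\<^sup>2)"
    using assms \<open>c > 0\<close> by simp
  have "s\<^sup>2 = (sqrt c)\<^sup>2 * t\<^sup>2 / (sqrt (1 + t\<^sup>2))\<^sup>2"
    by (subst s) (simp only: power_mult_distrib power_divide)
  then show "s\<^sup>2 = c * t\<^sup>2 / (1 + t\<^sup>2)"
    using \<open>c > 0\<close> by simp
qed

text \<open>In the slope variable the equilibrium equation loses its fractional power; this is the
  source of the parametrization of \<open>a\<close>.\<close>

lemma steady_state_parameter:
  fixes k c :: real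
  assumes "k > 0" "k\<^sup>2 < c" "k * sqrt (c - k\<^sup>2) ^ 3 = a" and q: "q = k / sqrt (c - k\<^sup>2)"
  shows "q > 0" "a = c\<^sup>2 * q / (1 + q\<^sup>2)\<^sup>2"
proof -
  define r where "r = sqrt (c - k\<^sup>2)"
  have r: "r > 0" "r\<^sup>2 = c - k\<^sup>2"
    using assms by (auto simp: r_def)
  have "c > 0" using assms(2) zero_le_power2[of k] by linarith
  show "q > 0" using assms by simp
  have "1 + q\<^sup>2 = c / r\<^sup>2"
    using one_plus_slope_squared[OF assms(2)] q r by simp
  moreover have "q = k / r" using q by (simp add: r_def)
  ultimately have "c\<^sup>2 * q / (1 + q\<^sup>2)\<^sup>2 = c\<^sup>2 * (k / r) / (c / r\<^sup>2)\<^sup>2"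
    by simp
  also have "\<dots> = k * r ^ 3"
    using \<open>c > 0\<close> r(1) by (simp add: field_simps power_numeral_reduce)
  finally show "a = c\<^sup>2 * q / (1 + q\<^sup>2)\<^sup>2"
    using assms(3) by (simp add: r_def)
qed

text \<open>An equilibrium is a critical point of the potential, so \<open>t = q\<close> is a double
  root; the remaining linear factor gives the turning point.\<close>

lemma energy_factorization:
  fixes c q t :: real
  shows "(1 + q\<^sup>2)\<^sup>2 * (1 + t\<^sup>2) *
      (c * t\<^sup>2 / (1 + t\<^sup>2) - c * q\<^sup>2 / (1 + q\<^sup>2) - 2 * (c * q / (1 + q\<^sup>2)\<^sup>2) * (t - q)) =
    c * (t - q)\<^sup>2 * (1 - q\<^sup>2 - 2 * q * t)"
proof -
  have "1 + t\<^sup>2 \<noteq> 0" "1 + q\<^sup>2 \<noteq> 0"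
    by (smt (verit) zero_le_power2)+
  then show ?thesis
    by (simp add: divide_simps) algebra
qed

text \<open>Thus \<open>a / c\<close> times the slope is an antiderivative of the singular force
  times \<psi>, which makes the energy explicit.\<close>

lemma profile_slope_derivative:
  assumes sol: "profile_solution c a \<phi> \<psi>"
  shows "((\<lambda>x. \<phi> x / sqrt (c - (\<phi> x)\<^sup>2)) has_real_derivative c * \<psi> x / sqrt (c - (\<phi> x)\<^sup>2) ^ 3) (at x)"
proof -
  define R where "R = (\<lambda>x. 1 / sqrt (c - (\<phi> x)\<^sup>2))"
  have "((\<lambda>x. \<phi> x * R x) has_real_derivative \<psi> x * R x + \<phi> x * (\<phi> x * \<psi> x * R x ^ 3)) (at x)"
    using DERIV_mult[OF profile_solutionD(2)[OF sol] profile_inverse_sqrt_derivative[OF sol], of x]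
    by (simp add: R_def mult.commute add.commute)
  moreover have "\<psi> x * R x + \<phi> x * (\<phi> x * \<psi> x * R x ^ 3) = c * \<psi> x * R x ^ 3"
  proof -
    have "(c - (\<phi> x)\<^sup>2) * (R x)\<^sup>2 = 1"
      using profile_solutionD(1)[OF sol, of x] by (simp add: R_def power_divide)
    then show ?thesis by algebra
  qed
  ultimately show ?thesis by (simp add: R_def power_divide)
qed

lemma profile_energy:
  assumes sol: "profile_solution c a \<phi> \<psi>" and lim: "(\<phi> \<longlongrightarrow> k) at_top" and "a > 0"
    and q: "q = k / sqrt (c - k\<^sup>2)" and t: "t = \<phi> x / sqrt (c - (\<phi> x)\<^sup>2)"
  shows "(1 + q\<^sup>2)\<^sup>2 * (1 + t\<^sup>2) * (\<psi> x)\<^sup>2 = c * (t - q)\<^sup>2 * (1 - q\<^sup>2 - 2 * q * t)"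
proof -
  note k = profile_limit_equation[OF sol lim \<open>a > 0\<close>]
  have "c > 0" using k(3) zero_le_power2[of k] by linarith
  define T where "T = (\<lambda>x. \<phi> x / sqrt (c - (\<phi> x)\<^sup>2))"
  \<comment> \<open>Multiplying the second-order equation by 2 \<psi> and integrating gives this
    first integral.\<close>
  define E where "E = (\<lambda>x. (\<psi> x)\<^sup>2 - (\<phi> x)\<^sup>2 + 2 * (a / c) * T x)"
  have T': "(T has_real_derivative c * \<psi> x / sqrt (c - (\<phi> x)\<^sup>2) ^ 3) (at x)" for x
    using profile_slope_derivative[OF sol] by (simp add: T_def)
  have E': "(E has_real_derivative 0) (at x)" for x
    unfolding E_def using \<open>c > 0\<close>
    by (auto intro!: derivative_eq_intros profile_solutionD(2,3)[OF sol] T' simp: algebra_simps)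
  have E: "(\<psi> x)\<^sup>2 = E 0 + (\<phi> x)\<^sup>2 - 2 * (a / c) * T x" for x
    using DERIV_isconst_all[of E x 0] E' by (simp add: E_def)
  \<comment> \<open>The energy level is read off along a sequence on which \<psi> tends to zero
    while \<phi> tends to \<open>k\<close>.\<close>
  obtain \<xi> :: "nat \<Rightarrow> real" where \<xi>: "filterlim \<xi> at_top sequentially" "(\<lambda>n. \<psi> (\<xi> n)) \<longlonglongrightarrow> 0"
    using limit_derivative_along_sequence[OF profile_solutionD(2)[OF sol] lim] by blast
  have l: "(\<lambda>n. \<phi> (\<xi> n)) \<longlonglongrightarrow> k"
    by (rule filterlim_compose[OF lim \<xi>(1)])
  have "(\<lambda>n. E 0 + (\<phi> (\<xi> n))\<^sup>2 - 2 * (a / c) * T (\<xi> n)) \<longlonglongrightarrow> E 0 + k\<^sup>2 - 2 * (a / c) * q"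
    unfolding T_def q using k(3) by (intro tendsto_intros l) auto
  moreover have "(\<lambda>n. (\<psi> (\<xi> n))\<^sup>2) \<longlonglongrightarrow> 0\<^sup>2"
    by (intro tendsto_intros \<xi>(2))
  ultimately have "E 0 + k\<^sup>2 - 2 * (a / c) * q = 0\<^sup>2"
    unfolding E[symmetric] by (rule LIMSEQ_unique)
  then have "(\<psi> x)\<^sup>2 = (\<phi> x)\<^sup>2 - k\<^sup>2 - 2 * (a / c) * (t - q)"
    using E[of x] by (simp add: T_def t algebra_simps)
  moreover have "a / c = c * q / (1 + q\<^sup>2)\<^sup>2"
    using steady_state_parameter(2)[OF k(2,3,1) q] \<open>c > 0\<close> by (simp add: power2_eq_square)
  ultimately have "(\<psi> x)\<^sup>2 = c * t\<^sup>2 / (1 + t\<^sup>2) - c * q\<^sup>2 / (1 + q\<^sup>2) - 2 * (c * q / (1 + q\<^sup>2)\<^sup>2) * (t - q)"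
    using slope_determines_value(2)[OF profile_solutionD(1)[OF sol] t]
      slope_determines_value(2)[OF k(3) q] by simp
  then show ?thesis
    using energy_factorization[of q t c] by simp
qed

section \<open>Excluding the equilibrium and locating the crest\<close>

lemma profile_never_rests:
  assumes sol: "profile_solution c a \<phi> \<psi>" and lim: "(\<phi> \<longlongrightarrow> k) at_top" and "a > 0"
    and "\<not> \<phi> constant_on UNIV"
  shows "\<not> (\<phi> x = k \<and> \<psi> x = 0)"
proof
  assume *: "\<phi> x = k \<and> \<psi> x = 0"
  note k = profile_limit_equation[OF sol lim \<open>a > 0\<close>]
  \<comment> \<open>The limit equation makes \<open>k\<close> an equilibrium, so the constant
    function solves the same initial value problem.\<close>
  have "k = a / sqrt (c - k\<^sup>2) ^ 3"
    using k by (simp add: field_simps flip: k(1))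
  then have "profile_solution c a (\<lambda>_. k) (\<lambda>_. 0)"
    using k(3) by (auto simp: profile_solution_def)
  then have "\<phi> = (\<lambda>_. k)"
    using profile_solution_unique[OF sol] * by blast
  then show False
    using assms(4) by (auto simp: constant_on_def)
qed

lemma steady_state_parameter_unique:
  fixes p q :: real
  assumes "0 < p" "3 * p\<^sup>2 < 1" "0 < q" "3 * q\<^sup>2 \<le> 1" "p / (1 + p\<^sup>2)\<^sup>2 = q / (1 + q\<^sup>2)\<^sup>2"
  shows "p = q"
proof -
  have nz: "1 + p\<^sup>2 \<noteq> 0" "1 + q\<^sup>2 \<noteq> 0"
    by (smt (verit) zero_le_power2)+
  have "p * (1 + q\<^sup>2)\<^sup>2 = q * (1 + p\<^sup>2)\<^sup>2"
    using assms(5) nz by (simp add: field_simps)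
  then have "(q - p) * (1 - p * q * (q\<^sup>2 + q * p + p\<^sup>2 + 2)) = 0"
    by algebra
  moreover have "p * q * (q\<^sup>2 + q * p + p\<^sup>2 + 2) < 1"
  proof -
    have pq: "2 * (p * q) \<le> p\<^sup>2 + q\<^sup>2"
      using sum_squares_bound[of p q] by simp
    \<comment> \<open>Each of \<open>p\<^sup>2\<close>, \<open>q\<^sup>2\<close> and
      \<open>p * q\<close> is at most 1/3, which gives the bound 3; strictness comes from
      \<open>3 * p\<^sup>2 < 1\<close>.\<close>
    have "p * q * (q\<^sup>2 + q * p + p\<^sup>2 + 2) \<le> p * q * 3"
      by (intro mult_left_mono) (use pq assms in \<open>simp_all add: mult.commute\<close>)
    also have "\<dots> < 1" using pq assms by simp
    finally show ?thesis .
  qed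
  ultimately show ?thesis by simp
qed

text \<open>At a rest point of \<psi> the factored energy leaves the double root or the linear
  factor. The double root would put the orbit on the equilibrium, so the crest value depends on
  \<open>c\<close> and \<open>p\<close> only.\<close>

lemma profile_crest:
  assumes sol: "profile_solution c a \<phi> \<psi>" and lim: "(\<phi> \<longlongrightarrow> k) at_top" and "c > 0"
    and p: "0 < p" "3 * p\<^sup>2 < 1" "a = c\<^sup>2 * p / (1 + p\<^sup>2)\<^sup>2"
    and nonconst: "\<not> \<phi> constant_on UNIV" and "\<psi> 0 = 0"
    and m: "m = (1 - p\<^sup>2) / (2 * p)"
  shows "\<phi> 0 = sqrt c * m / sqrt (1 + m\<^sup>2)"
proof -
  have "1 + p\<^sup>2 > 0" by (smt (verit) zero_le_power2)
  then have "a > 0" using p \<open>c > 0\<close> by simp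
  note k = profile_limit_equation[OF sol lim \<open>a > 0\<close>]
  define q where "q = k / sqrt (c - k\<^sup>2)"
  define t where "t = (\<lambda>x. \<phi> x / sqrt (c - (\<phi> x)\<^sup>2))"
  note q = steady_state_parameter[OF k(2,3,1) q_def]
  note energy = profile_energy[OF sol lim \<open>a > 0\<close> q_def fun_cong[OF t_def]]
  have rest: "\<phi> x = k" if "t x = q" for x
    using slope_determines_value(1)[OF profile_solutionD(1)[OF sol, of x] fun_cong[OF t_def]]
      slope_determines_value(1)[OF k(3) q_def] that by simp
  have still: "\<psi> x = 0" if "(1 + q\<^sup>2)\<^sup>2 * (1 + (t x)\<^sup>2) * (\<psi> x)\<^sup>2 = 0" for x
    using that by (smt (verit) mult_eq_0_iff zero_le_power2 power_eq_0_iff)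
  have "3 * q\<^sup>2 \<le> 1"
  proof (rule ccontr)
    assume "\<not> 3 * q\<^sup>2 \<le> 1"
    \<comment> \<open>The linear factor has a negative limit here. At a point where it is negative,
      the two sides of the energy identity have opposite weak signs, so both vanish and the orbit
      sits on the equilibrium.\<close>
    then have neg: "1 - q\<^sup>2 - 2 * q * q < 0" by (simp add: power2_eq_square)
    have "(t \<longlongrightarrow> q) at_top"
      unfolding t_def q_def using k(3) by (intro tendsto_intros lim) auto
    then have "((\<lambda>x. 1 - q\<^sup>2 - 2 * q * t x) \<longlongrightarrow> 1 - q\<^sup>2 - 2 * q * q) at_top"
      by (intro tendsto_intros)
    then have "eventually (\<lambda>x. 1 - q\<^sup>2 - 2 * q * t x < 0) at_top"
      using neg order_tendstoD(2) by blast
    then obtain x where x: "1 - q\<^sup>2 - 2 * q * t x < 0"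
      using eventually_happens trivial_limit_at_top_linorder by blast
    have "(1 + q\<^sup>2)\<^sup>2 * (1 + (t x)\<^sup>2) * (\<psi> x)\<^sup>2 \<ge> 0"
      by (intro mult_nonneg_nonneg add_nonneg_nonneg) auto
    moreover have "c * (t x - q)\<^sup>2 * (1 - q\<^sup>2 - 2 * q * t x) \<le> 0"
      using x \<open>c > 0\<close> by (intro mult_nonneg_nonpos) auto
    ultimately have z: "c * (t x - q)\<^sup>2 * (1 - q\<^sup>2 - 2 * q * t x) = 0"
      using energy[of x] by simp
    then have "t x = q" using x \<open>c > 0\<close> by simp
    moreover have "\<psi> x = 0" using still[of x] z energy[of x] by simp
    ultimately show False
      using rest profile_never_rests[OF sol lim \<open>a > 0\<close> nonconst] by blast
  qed
  moreover have "p / (1 + p\<^sup>2)\<^sup>2 = q / (1 + q\<^sup>2)\<^sup>2"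
  proof -
    have "c\<^sup>2 * (p / (1 + p\<^sup>2)\<^sup>2) = c\<^sup>2 * (q / (1 + q\<^sup>2)\<^sup>2)"
      using p(3) q(2) by simp
    then show ?thesis using \<open>c > 0\<close> by (subst (asm) mult_cancel_left) simp
  qed
  ultimately have "p = q"
    using steady_state_parameter_unique p q by blast
  have "c * (t 0 - q)\<^sup>2 * (1 - q\<^sup>2 - 2 * q * t 0) = 0"
    using energy[of 0] \<open>\<psi> 0 = 0\<close> by simp
  moreover have "t 0 \<noteq> q"
    using rest profile_never_rests[OF sol lim \<open>a > 0\<close> nonconst] \<open>\<psi> 0 = 0\<close> by blast
  ultimately have "1 - p\<^sup>2 - 2 * p * t 0 = 0"
    using \<open>c > 0\<close> \<open>p = q\<close> by simp
  then have "t 0 = m"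
    using p(1) by (simp add: m field_simps)
  then show ?thesis
    using slope_determines_value(1)[OF profile_solutionD(1)[OF sol, of 0] fun_cong[OF t_def]] by simp
qed

subsection \<open>Construction of the wave\<close>

lemma linear_growth:
  fixes f f' :: "real \<Rightarrow> real"
  assumes "\<And>x. (f has_real_derivative f' x) (at x)" "\<And>x. \<epsilon> \<le> f' x" "x \<le> y"
  shows "\<epsilon> * (y - x) \<le> f y - f x"
proof -
  have "f x - \<epsilon> * x \<le> f y - \<epsilon> * y"
  proof (rule DERIV_nonneg_imp_nondecreasing[OF \<open>x \<le> y\<close>])
    fix z
    have "((\<lambda>x. f x - \<epsilon> * x) has_real_derivative f' z - \<epsilon>) (at z)"
      by (auto intro!: derivative_eq_intros assms(1))
    then show "\<exists>d. ((\<lambda>x. f x - \<epsilon> * x) has_real_derivative d) (at z) \<and> 0 \<le> d"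
      using assms(2)[of z] by auto
  qed
  then show ?thesis by (simp add: algebra_simps)
qed

lemma linear_growth_limits:
  fixes f f' :: "real \<Rightarrow> real"
  assumes "\<And>x. (f has_real_derivative f' x) (at x)" "\<And>x. \<epsilon> \<le> f' x" "\<epsilon> > 0"
  shows "filterlim f at_top at_top" "filterlim f at_bot at_bot"
proof -
  have "filterlim (\<lambda>x. f 0 + \<epsilon> * x) at_top at_top"
    using \<open>\<epsilon> > 0\<close>
    by (intro filterlim_tendsto_add_at_top[OF tendsto_const]
        filterlim_tendsto_pos_mult_at_top[OF tendsto_const _ filterlim_ident])
  moreover have "eventually (\<lambda>x. f 0 + \<epsilon> * x \<le> f x) at_top"
    using eventually_ge_at_top[of 0]
  proof eventually_elim
    case (elim x)
    then show ?case using linear_growth[OF assms(1,2), of 0 x] by simp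
  qed
  ultimately show "filterlim f at_top at_top"
    by (rule filterlim_at_top_mono)
  have "filterlim (\<lambda>x. - f 0 + \<epsilon> * x) at_top at_top"
    using \<open>\<epsilon> > 0\<close>
    by (intro filterlim_tendsto_add_at_top[OF tendsto_const]
        filterlim_tendsto_pos_mult_at_top[OF tendsto_const _ filterlim_ident])
  moreover have "eventually (\<lambda>x. - f 0 + \<epsilon> * x \<le> - f (- x)) at_top"
    using eventually_ge_at_top[of 0]
  proof eventually_elim
    case (elim x)
    then show ?case using linear_growth[OF assms(1,2), of "- x" 0] by simp
  qed
  ultimately have "filterlim (\<lambda>x. - f (- x)) at_top at_top"
    by (rule filterlim_at_top_mono)
  then show "filterlim f at_bot at_bot"
    by (simp add: filterlim_at_bot_mirror filterlim_uminus_at_bot)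
qed

text \<open>Separation of variables: the solution is the inverse of an antiderivative of \<open>1 / g\<close>.\<close>

lemma autonomous_ode_solution:
  fixes g :: "real \<Rightarrow> real"
  assumes cont: "\<And>x. isCont g x" and bounds: "\<And>x. \<epsilon> \<le> g x" "\<And>x. g x \<le> B" and "\<epsilon> > 0"
  shows "\<exists>y. y 0 = 0 \<and> (\<forall>x. (y has_real_derivative g (y x)) (at x))"
proof -
  have pos: "g x > 0" for x using bounds(1)[of x] \<open>\<epsilon> > 0\<close> by simp
  have "B > 0" using pos[of 0] bounds(2)[of 0] by simp
  have "\<And>x. isCont (\<lambda>x. 1 / g x) x"
    using cont pos by (intro continuous_intros) (auto simp: less_imp_neq[symmetric])
  then obtain F0 where F0: "\<And>x. (F0 has_vector_derivative 1 / g x) (at x)"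
    using einterval_antiderivative[of "-\<infinity>" "\<infinity>" "\<lambda>x. 1 / g x"] by auto
  \<comment> \<open>This normalization yields \<open>y 0 = 0\<close> for the inverse.\<close>
  define F where "F = (\<lambda>x. F0 x - F0 0)"
  have F: "(F has_real_derivative 1 / g x) (at x)" for x
    using F0[of x] unfolding F_def
    by (auto intro!: derivative_eq_intros simp: has_real_derivative_iff_has_vector_derivative[symmetric])
  have F_ge: "1 / B \<le> 1 / g x" for x
    using bounds(2)[of x] pos[of x] by (intro divide_left_mono) auto
  have isCont_F: "isCont F x" for x
    using F DERIV_isCont by blast
  have growth: "1 / B * (y - x) \<le> F y - F x" if "x \<le> y" for x y
    by (rule linear_growth[OF F F_ge that])
  have "strict_mono F"
  proof (rule strict_monoI)
    fix x y :: real assume "x < y"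
    then have "1 / B * (y - x) > 0" using \<open>B > 0\<close> by simp
    then show "F x < F y" using growth[of x y] \<open>x < y\<close> by simp
  qed
  then have "inj F" by (rule strict_mono_imp_inj_on)
  have "surj F"
  proof (rule surjI)
    fix z
    \<comment> \<open>\<open>F\<close> vanishes at 0 and grows at rate at least
      \<open>1 / B\<close>, so its values at \<open>- b\<close> and \<open>b\<close> enclose
      \<open>z\<close>.\<close>
    define b where "b = B * \<bar>z\<bar>"
    have "b \<ge> 0" using \<open>B > 0\<close> by (simp add: b_def)
    moreover have "\<bar>z\<bar> \<le> F b" "F (- b) \<le> - \<bar>z\<bar>"
      using growth[of 0 b] growth[of "- b" 0] \<open>b \<ge> 0\<close> \<open>B > 0\<close> by (auto simp: b_def F_def)
    ultimately have "\<exists>x\<ge>-b. x \<le> b \<and> F x = z"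
      by (intro IVT) (use isCont_F in auto)
    then show "F (inv F z) = z"
      by (metis f_inv_into_f rangeI)
  qed
  define y where "y = inv F"
  have yF: "y (F x) = x" for x using \<open>inj F\<close> by (simp add: y_def)
  have Fy: "F (y x) = x" for x using \<open>surj F\<close> by (simp add: y_def surj_f_inv_f)
  have "isCont y x" for x
    using isCont_inverse_function[of 1 "y x" y F] yF isCont_F by (simp add: Fy)
  then have "(y has_real_derivative inverse (1 / g (y x))) (at x)" for x
    using pos[of "y x"] by (intro DERIV_inverse_function[OF F, of _ _ "x - 1" "x + 1"]) (auto simp: Fy)
  moreover have "y 0 = 0" using yF[of 0] by (simp add: F_def)
  ultimately show ?thesis by auto
qed

text \<open>In the variable \<open>w\<close> with \<open>w\<^sup>2 = 1 - p\<^sup>2 - 2 p t\<close> the homoclinic orbit becomes a heteroclinic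
  orbit of a first-order equation between \<open>\<plusminus>W\<close>; substituting \<open>w = W tanh y\<close> makes the right-hand
  side bounded above and away from zero.\<close>

lemma desingularized_orbit:
  fixes p :: real
  assumes p: "0 < p" "3 * p\<^sup>2 < 1"
    and T: "T = (\<lambda>w. (1 - p\<^sup>2 - w\<^sup>2) / (2 * p))" and W: "W = sqrt (1 - 3 * p\<^sup>2)"
  obtains w where "w 0 = 0" "\<And>x. x > 0 \<Longrightarrow> w x > 0"
    "\<And>x. (w has_real_derivative p * (1 + (T (w x))\<^sup>2) * (T (w x) - p) / (1 + p\<^sup>2)) (at x)"
    "\<And>x. p < T (w x)" "(w \<longlongrightarrow> W) at_top" "(w \<longlongrightarrow> - W) at_bot"
proof -
  have W2: "W > 0" "W\<^sup>2 = 1 - 3 * p\<^sup>2" using p by (auto simp: W)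
  have p2: "1 + p\<^sup>2 > 0" by (smt (verit) zero_le_power2)
  \<comment> \<open>\<open>W\<close> is chosen so that \<open>T\<close> equals \<open>p\<close>
    exactly at \<plusminus>\<open>W\<close>; the factor that vanishes there is
    \<open>1 - tanh\<^sup>2\<close>.\<close>
  have T_minus: "T (W * tanh y) - p = W\<^sup>2 * (1 - (tanh y)\<^sup>2) / (2 * p)" for y
    unfolding T power_mult_distrib W2(2) using p(1) by (simp add: field_simps power2_eq_square)
  have tanh2: "(tanh y)\<^sup>2 < 1" for y :: real
    using tanh_real_bounds[of y] by (auto simp: abs_square_less_1)
  have T_gt: "p < T (W * tanh y)" for y
    using T_minus[of y] tanh2[of y] W2(1) p(1)
    by (smt (verit) divide_pos_pos mult_pos_pos zero_less_power)
  have T_le: "T (W * tanh y) \<le> (1 - p\<^sup>2) / (2 * p)" for y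
    using p(1) by (simp add: T divide_right_mono)
  \<comment> \<open>Inserting w = W tanh y into the equation for \<open>w\<close>, the factor
    \<open>1 - tanh\<^sup>2\<close> cancels on both sides and y' = g(y) remains.\<close>
  define g where "g = (\<lambda>y. W * (1 + (T (W * tanh y))\<^sup>2) / (2 * (1 + p\<^sup>2)))"
  have cont: "isCont g y" for y
    unfolding g_def T using p p2 by (intro continuous_intros) auto
  \<comment> \<open>The lower bound drops the square of \<open>T\<close>; the upper one uses that
    \<open>T\<close> is positive and largest at w = 0.\<close>
  have lower: "W / (2 * (1 + p\<^sup>2)) \<le> g y" for y
    unfolding g_def using W2(1) p2 by (intro divide_right_mono) auto
  have upper: "g y \<le> W * (1 + ((1 - p\<^sup>2) / (2 * p))\<^sup>2) / (2 * (1 + p\<^sup>2))" for y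
    unfolding g_def using W2(1) p2 T_gt[of y] T_le[of y] p(1)
    by (intro divide_right_mono mult_left_mono add_left_mono power_mono) auto
  have \<epsilon>: "W / (2 * (1 + p\<^sup>2)) > 0" using W2(1) p2 by simp
  obtain y where y: "y 0 = 0" "\<And>x. (y has_real_derivative g (y x)) (at x)"
    using autonomous_ode_solution[OF cont lower upper \<epsilon>] by blast
  note y_lim = linear_growth_limits[OF y(2) lower \<epsilon>]
  have y_pos: "y x > 0" if "x > 0" for x
    using linear_growth[OF y(2) lower, of 0 x] y(1) that \<epsilon> mult_pos_pos[OF \<epsilon> that] by simp
  show ?thesis
  proof (rule that[of "\<lambda>x. W * tanh (y x)"])
    fix x
    have "((\<lambda>x. W * tanh (y x)) has_real_derivative W * ((1 - (tanh (y x))\<^sup>2) * g (y x))) (at x)"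
      by (auto intro!: derivative_eq_intros y(2))
    also have "W * ((1 - (tanh (y x))\<^sup>2) * g (y x)) =
        W\<^sup>2 * (1 - (tanh (y x))\<^sup>2) * (1 + (T (W * tanh (y x)))\<^sup>2) / (2 * (1 + p\<^sup>2))"
      by (simp add: g_def power2_eq_square)
    also have "\<dots> = p * (1 + (T (W * tanh (y x)))\<^sup>2) * (T (W * tanh (y x)) - p) / (1 + p\<^sup>2)"
      unfolding T_minus using p(1) by simp
    finally show "((\<lambda>x. W * tanh (y x)) has_real_derivative
      p * (1 + (T (W * tanh (y x)))\<^sup>2) * (T (W * tanh (y x)) - p) / (1 + p\<^sup>2)) (at x)" .
  next
    have "((\<lambda>x. W * tanh (y x)) \<longlongrightarrow> W * 1) at_top"
      by (intro tendsto_mult tendsto_const filterlim_compose[OF tanh_real_at_top y_lim(1)])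
    then show "((\<lambda>x. W * tanh (y x)) \<longlongrightarrow> W) at_top" by simp
    have "((\<lambda>x. W * tanh (y x)) \<longlongrightarrow> W * (- 1)) at_bot"
      by (intro tendsto_mult tendsto_const filterlim_compose[OF tanh_real_at_bot y_lim(2)])
    then show "((\<lambda>x. W * tanh (y x)) \<longlongrightarrow> - W) at_bot" by simp
  qed (use y(1) y_pos W2(1) T_gt in auto)
qed

text \<open>Because \<open>w\<close> carries a sign, one formula gives \<phi>' on both sides of the
  crest; solving the energy identity for \<phi>' directly would require choosing a branch of the
  root there.\<close>

lemma profile_from_orbit:
  fixes c p a :: real
  assumes "c > 0" and p: "0 < p" "a = c\<^sup>2 * p / (1 + p\<^sup>2)\<^sup>2"
    and t: "\<And>x. t x = (1 - p\<^sup>2 - (w x)\<^sup>2) / (2 * p)"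
    and w: "\<And>x. (w has_real_derivative p * (1 + (t x)\<^sup>2) * (t x - p) / (1 + p\<^sup>2)) (at x)"
  shows "profile_solution c a (\<lambda>x. sqrt c * t x / sqrt (1 + (t x)\<^sup>2))
    (\<lambda>x. - sqrt c * w x * (t x - p) / ((1 + p\<^sup>2) * sqrt (1 + (t x)\<^sup>2)))"
proof -
  have p2: "1 + p\<^sup>2 > 0" by (smt (verit) zero_le_power2)
  \<comment> \<open>Naming the two reciprocals and recording their defining relations turns the
    derivative computations into polynomial identities.\<close>
  define r where "r = (\<lambda>x. 1 / sqrt (1 + (t x)\<^sup>2))"
  define b where "b = 1 / (1 + p\<^sup>2)"
  have b: "(1 + p\<^sup>2) * b = 1" using p2 by (simp add: b_def)
  have one_t: "1 + (t x)\<^sup>2 > 0" for x by (smt (verit) zero_le_power2)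
  have r: "r x > 0" "(r x)\<^sup>2 * (1 + (t x)\<^sup>2) = 1" for x
    using one_t[of x] by (auto simp: r_def power_divide)
  have w2: "(w x)\<^sup>2 = 1 - p\<^sup>2 - 2 * p * t x" for x
    using p(1) by (simp add: t)
  have w': "(w has_real_derivative p * (1 + (t x)\<^sup>2) * (t x - p) * b) (at x)" for x
    using w[of x] by (simp add: b_def)
  have t': "(t has_real_derivative - w x * (1 + (t x)\<^sup>2) * (t x - p) * b) (at x)" for x
  proof -
    have "((\<lambda>x. (1 - p\<^sup>2 - (w x)\<^sup>2) / (2 * p)) has_real_derivative
        - (2 * w x * (p * (1 + (t x)\<^sup>2) * (t x - p) * b)) / (2 * p)) (at x)"
      using p(1) by (auto intro!: derivative_eq_intros w')
    then show ?thesis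
      using p(1) by (simp add: t[symmetric] mult.assoc)
  qed
  have r': "(r has_real_derivative t x * w x * (t x - p) * b * r x) (at x)" for x
  proof -
    have "(r has_real_derivative - (t x * (- w x * (1 + (t x)\<^sup>2) * (t x - p) * b)) * r x ^ 3) (at x)"
      unfolding r_def using one_t[of x]
      by (auto intro!: derivative_eq_intros t' simp: power3_eq_cube divide_simps less_imp_neq[symmetric])
    moreover have "- (t x * (- w x * (1 + (t x)\<^sup>2) * (t x - p) * b)) * r x ^ 3 =
        t x * w x * (t x - p) * b * r x"
      using r(2)[of x] by algebra
    ultimately show ?thesis by (rule DERIV_cong)
  qed
  have first: "((\<lambda>x. sqrt c * t x * r x) has_real_derivative - sqrt c * w x * (t x - p) * b * r x) (at x)" for x
  proof -
    have "((\<lambda>x. sqrt c * t x * r x) has_real_derivative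
        sqrt c * (- w x * (1 + (t x)\<^sup>2) * (t x - p) * b) * r x +
        sqrt c * t x * (t x * w x * (t x - p) * b * r x)) (at x)"
      by (auto intro!: derivative_eq_intros t' r')
    moreover have "sqrt c * (- w x * (1 + (t x)\<^sup>2) * (t x - p) * b) * r x +
        sqrt c * t x * (t x * w x * (t x - p) * b * r x) = - sqrt c * w x * (t x - p) * b * r x"
      by (simp add: algebra_simps power2_eq_square)
    ultimately show ?thesis by simp
  qed
  have second: "((\<lambda>x. - sqrt c * w x * (t x - p) * b * r x) has_real_derivative
      sqrt c * (t x * r x - p * b\<^sup>2 * (1 + (t x)\<^sup>2)\<^sup>2 * r x)) (at x)" for x
  proof -
    have "((\<lambda>x. - sqrt c * w x * (t x - p) * b * r x) has_real_derivative
        - sqrt c * b * ((p * (1 + (t x)\<^sup>2) * (t x - p) * b) * (t x - p) * r x +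
          w x * (- w x * (1 + (t x)\<^sup>2) * (t x - p) * b) * r x +
          w x * (t x - p) * (t x * w x * (t x - p) * b * r x))) (at x)"
      by (rule derivative_eq_intros w' t' r' refl)+ (simp add: algebra_simps)
    moreover have "- sqrt c * b * ((p * (1 + (t x)\<^sup>2) * (t x - p) * b) * (t x - p) * r x +
          w x * (- w x * (1 + (t x)\<^sup>2) * (t x - p) * b) * r x +
          w x * (t x - p) * (t x * w x * (t x - p) * b * r x)) =
        sqrt c * (t x * r x - p * b\<^sup>2 * (1 + (t x)\<^sup>2)\<^sup>2 * r x)"
      using w2[of x] b by algebra
    ultimately show ?thesis by (rule DERIV_cong)
  qed
  have sq: "c - (sqrt c * t x * r x)\<^sup>2 = c * (r x)\<^sup>2" for x
  proof -
    have "c - (sqrt c * t x * r x)\<^sup>2 = c * (1 - (t x)\<^sup>2 * (r x)\<^sup>2)"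
      using \<open>c > 0\<close> by (simp add: power_mult_distrib algebra_simps)
    also have "1 - (t x)\<^sup>2 * (r x)\<^sup>2 = (r x)\<^sup>2"
      using r(2)[of x] by algebra
    finally show ?thesis .
  qed
  have bound: "(sqrt c * t x * r x)\<^sup>2 < c" for x
    using sq[of x] mult_pos_pos[OF \<open>c > 0\<close> zero_less_power[OF r(1)[of x], of 2]] by simp
  \<comment> \<open>The value of c - \<phi>^2 found above is a perfect square, so the singular force
    reduces to a polynomial in \<open>t\<close> and \<open>r\<close>, matching the second term of
    the derivative of \<psi>.\<close>
  have force: "a / sqrt (c - (sqrt c * t x * r x)\<^sup>2) ^ 3 = sqrt c * (p * b\<^sup>2 * (1 + (t x)\<^sup>2)\<^sup>2 * r x)" for x
  proof -
    have "sqrt (c - (sqrt c * t x * r x)\<^sup>2) = sqrt c * r x"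
      unfolding sq using r(1)[of x] by (simp add: real_sqrt_mult)
    moreover have "a = (sqrt c) ^ 4 * p * b\<^sup>2"
      using \<open>c > 0\<close> p2 by (simp add: p(2) b_def power_divide power_numeral_reduce)
    moreover have "sqrt c ^ 4 * p * b\<^sup>2 = sqrt c * (p * b\<^sup>2 * (1 + (t x)\<^sup>2)\<^sup>2 * r x) * (sqrt c * r x) ^ 3"
      using r(2)[of x] by algebra
    ultimately show ?thesis
      using \<open>c > 0\<close> r(1)[of x] by (simp add: divide_eq_eq)
  qed
  have "profile_solution c a (\<lambda>x. sqrt c * t x * r x) (\<lambda>x. - sqrt c * w x * (t x - p) * b * r x)"
    unfolding profile_solution_def force
    using bound first second by (simp add: algebra_simps)
  then show ?thesis
    by (simp add: r_def b_def)
qed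

lemma solitary_wave_exists:
  fixes c p a :: real
  assumes "c > 0" and p: "0 < p" "3 * p\<^sup>2 < 1" "a = c\<^sup>2 * p / (1 + p\<^sup>2)\<^sup>2"
  shows "\<exists>\<phi>. novikov_wave_profile c a \<phi> \<and> strict_antimono_on {0<..} \<phi>"
proof -
  have p2: "1 + p\<^sup>2 > 0" by (smt (verit) zero_le_power2)
  have "a > 0" using p p2 \<open>c > 0\<close> by simp
  define T where "T = (\<lambda>w. (1 - p\<^sup>2 - w\<^sup>2) / (2 * p))"
  define W where "W = sqrt (1 - 3 * p\<^sup>2)"
  obtain w where w: "w 0 = 0" "\<And>x. x > 0 \<Longrightarrow> w x > 0"
    "\<And>x. (w has_real_derivative p * (1 + (T (w x))\<^sup>2) * (T (w x) - p) / (1 + p\<^sup>2)) (at x)"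
    "\<And>x. p < T (w x)" "(w \<longlongrightarrow> W) at_top" "(w \<longlongrightarrow> - W) at_bot"
    using desingularized_orbit[OF p(1,2) T_def W_def] by blast
  define t where "t = (\<lambda>x. T (w x))"
  define \<phi> where "\<phi> = (\<lambda>x. sqrt c * t x / sqrt (1 + (t x)\<^sup>2))"
  define \<psi> where "\<psi> = (\<lambda>x. - sqrt c * w x * (t x - p) / ((1 + p\<^sup>2) * sqrt (1 + (t x)\<^sup>2)))"
  have one_t: "1 + z\<^sup>2 > 0" for z :: real by (smt (verit) zero_le_power2)
  have sol: "profile_solution c a \<phi> \<psi>"
    unfolding \<phi>_def \<psi>_def
    by (rule profile_from_orbit[OF \<open>c > 0\<close> p(1,3)]) (use w(3) in \<open>auto simp: t_def T_def\<close>)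
  have decreasing: "\<phi> y < \<phi> x" if "0 < x" "x < y" for x y
  proof (rule DERIV_neg_imp_decreasing[OF \<open>x < y\<close>])
    \<comment> \<open>By its formula \<psi> has the sign opposite to \<open>w\<close>, since
      \<open>t\<close> stays above \<open>p\<close>.\<close>
    fix z assume "x \<le> z"
    then have "w z > 0" "t z - p > 0" using w(2)[of z] w(4)[of z] that by (auto simp: t_def)
    then have "\<psi> z < 0"
      using \<open>c > 0\<close> p2 one_t[of "t z"] by (auto simp: \<psi>_def intro!: divide_pos_pos mult_pos_pos)
    then show "\<exists>d. (\<phi> has_real_derivative d) (at z) \<and> d < 0"
      using profile_solutionD(2)[OF sol] by blast
  qed
  have "\<not> \<phi> constant_on UNIV"
    using decreasing[of 1 2] by (force simp: constant_on_def)
  moreover have "W\<^sup>2 = 1 - 3 * p\<^sup>2"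
    using p by (simp add: W_def)
  \<comment> \<open>Both ends of the heteroclinic orbit of \<open>w\<close> have the same image
    under \<open>T\<close>, so the orbit of \<phi> is homoclinic.\<close>
  then have "T W = p" "T (- W) = p"
    using p(1) by (simp_all add: T_def field_simps power2_eq_square)
  then have "(t \<longlongrightarrow> p) F" if "(w \<longlongrightarrow> W) F \<or> (w \<longlongrightarrow> - W) F" for F
  proof -
    have "(t \<longlongrightarrow> T L) F" if "(w \<longlongrightarrow> L) F" for L
      unfolding t_def T_def using p(1) by (intro tendsto_intros that) auto
    then show ?thesis using that \<open>T W = p\<close> \<open>T (- W) = p\<close> by metis
  qed
  then have "(\<phi> \<longlongrightarrow> sqrt c * p / sqrt (1 + p\<^sup>2)) F" if "(w \<longlongrightarrow> W) F \<or> (w \<longlongrightarrow> - W) F" for F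
    unfolding \<phi>_def using that p2 by (intro tendsto_intros) auto
  then have "(\<phi> \<longlongrightarrow> sqrt c * p / sqrt (1 + p\<^sup>2)) at_top" "(\<phi> \<longlongrightarrow> sqrt c * p / sqrt (1 + p\<^sup>2)) at_bot"
    using w(5,6) by auto
  ultimately have "novikov_wave_profile c a \<phi>"
    using w(1) by (intro novikov_wave_profileI[OF sol \<open>a > 0\<close>]) (auto simp: \<psi>_def)
  moreover have "strict_antimono_on {0<..} \<phi>"
    using decreasing by (auto simp: monotone_on_def)
  ultimately show ?thesis by blast
qed

section \<open>Uniqueness, symmetry and the choice of the parameter\<close>

lemma wave_profile_unique:
  fixes c p a :: real
  assumes "c > 0" and p: "0 < p" "3 * p\<^sup>2 < 1" "a = c\<^sup>2 * p / (1 + p\<^sup>2)\<^sup>2"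
    and \<phi>: "novikov_wave_profile c a \<phi>" and \<psi>: "novikov_wave_profile c a \<psi>"
  shows "\<phi> = \<psi>"
proof -
  \<comment> \<open>Any two profiles share this crest value and have zero slope at the origin, hence
    the same initial data.\<close>
  have "\<omega> 0 = sqrt c * ((1 - p\<^sup>2) / (2 * p)) / sqrt (1 + ((1 - p\<^sup>2) / (2 * p))\<^sup>2)"
    if "novikov_wave_profile c a \<omega>" for \<omega>
    using profile_crest[OF novikov_wave_profileD(1)[OF that] _ \<open>c > 0\<close> p
        novikov_wave_profileD(3,2)[OF that] refl] novikov_wave_profileD(4)[OF that] by blast
  from this[OF \<phi>] this[OF \<psi>] have "\<phi> 0 = \<psi> 0" by (rule trans[OF _ sym])
  then show ?thesis
    using profile_solution_unique[OF novikov_wave_profileD(1)[OF \<phi>] novikov_wave_profileD(1)[OF \<psi>]]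
      novikov_wave_profileD(2)[OF \<phi>] novikov_wave_profileD(2)[OF \<psi>] by simp
qed

text \<open>Reflection preserves the equation and, as the derivative vanishes at 0, also the initial
  data.\<close>

lemma wave_profile_even:
  assumes "novikov_wave_profile c a \<phi>"
  shows "\<phi> (- x) = \<phi> x"
proof -
  note sol = novikov_wave_profileD(1)[OF assms]
  have "profile_solution c a (\<lambda>x. \<phi> (- x)) (\<lambda>x. - deriv \<phi> (- x))"
    unfolding profile_solution_def
    using profile_solutionD(1)[OF sol] has_real_derivative_reflect[OF profile_solutionD(2)[OF sol]]
      DERIV_minus[OF has_real_derivative_reflect[OF profile_solutionD(3)[OF sol]]] by simp
  from profile_solution_unique[OF this sol, of 0]
  have "(\<lambda>x. \<phi> (- x)) = \<phi>"
    using novikov_wave_profileD(2)[OF assms] by simp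
  then show ?thesis by metis
qed

text \<open>The upper bound on \<open>a\<close> is the value of the parametrization at p = 1/sqrt 3,
  so the intermediate value theorem applies; the strict inequalities exclude both endpoints.\<close>

lemma steady_state_parameter_exists:
  fixes c a :: real
  assumes "c > 0" "0 < a" "a < 3 * sqrt 3 * c\<^sup>2 / 16"
  obtains p where "0 < p" "3 * p\<^sup>2 < 1" "a = c\<^sup>2 * p / (1 + p\<^sup>2)\<^sup>2"
proof -
  define h where "h = (\<lambda>p::real. c\<^sup>2 * p / (1 + p\<^sup>2)\<^sup>2)"
  have one_p: "1 + p\<^sup>2 > 0" for p :: real by (smt (verit) zero_le_power2)
  have h_end: "h (sqrt 3 / 3) = 3 * sqrt 3 * c\<^sup>2 / 16"
    by (simp add: h_def power_divide field_simps)
  have "\<exists>p\<ge>0. p \<le> sqrt 3 / 3 \<and> h p = a"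
  proof (rule IVT')
    have "1 + p\<^sup>2 \<noteq> 0" for p :: real using one_p[of p] by simp
    then show "continuous_on {0..sqrt 3 / 3} h"
      unfolding h_def by (intro continuous_intros) auto
  qed (use assms h_end in \<open>auto simp: h_def\<close>)
  then obtain p where p: "p \<ge> 0" "p \<le> sqrt 3 / 3" "h p = a" by blast
  have "p \<noteq> 0" using p(3) assms(2) by (auto simp: h_def)
  moreover have "p \<noteq> sqrt 3 / 3" using p(3) assms(3) h_end by force
  ultimately have "0 < p" "p < sqrt 3 / 3" using p by auto
  then have "p\<^sup>2 < (sqrt 3 / 3)\<^sup>2" by (intro power_strict_mono) auto
  then have "3 * p\<^sup>2 < 1" by (simp add: power_divide)
  with \<open>0 < p\<close> p(3) that show ?thesis by (auto simp: h_def)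
qed

theorem theorem2p1:
  fixes c a :: real
  assumes "c > 0" and "0 < a" and "a < 3 * sqrt 3 * c\<^sup>2 / 16"
  shows "(\<exists>!\<phi>. novikov_wave_profile c a \<phi>) \<and>
         (\<forall>\<phi>. novikov_wave_profile c a \<phi> \<longrightarrow>
            (\<forall>x. \<phi> (- x) = \<phi> x) \<and> strict_antimono_on {0<..} \<phi>)"
proof -
  obtain p where p: "0 < p" "3 * p\<^sup>2 < 1" "a = c\<^sup>2 * p / (1 + p\<^sup>2)\<^sup>2"
    using steady_state_parameter_exists[OF assms] .
  obtain \<phi> where \<phi>: "novikov_wave_profile c a \<phi>" "strict_antimono_on {0<..} \<phi>"
    using solitary_wave_exists[OF assms(1) p] by blast
  have unique: "\<psi> = \<phi>" if "novikov_wave_profile c a \<psi>" for \<psi>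
    by (rule wave_profile_unique[OF assms(1) p that \<phi>(1)])
  \<comment> \<open>Monotonicity is known for the constructed wave and passes to every profile by
    uniqueness.\<close>
  show ?thesis
    using \<phi> unique wave_profile_even by blast
qed

end
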